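(* Let $X$ be a birth-and-death process on $S=\{0,1,2,\dots\}$ with birth rates $\lambda_i>0$ and death rates $\mu_i>0$ for $i\ge 1$, and with $0$ a trap. Let $f_i$ ($i\ge1$) be the density of the first hitting time $T_0$ of $0$ under $\mathbb{P}_i$, and let $\psi_{\partial_t}(j)$ be the differential polynomial $\psi_{\partial_t}(j)=\sum_{k=1}^{j}C(j,k)\,\partial_t^{k-1}$ ($j\ge1$), with the matrix $C$ defined in the context. Let $\nu$ be a probability measure on $S\setminus\{0\}$ and $f_\nu(t):=\sum_{i=1}^{\infty}\nu\{i\}f_i(t)$ ($t>0$). Then $$\nu\{j\}=\lim_{t\to+0}\psi_{\partial_t}(j)f_{\nu}(t)\qquad(j\ge 1).$$
   Context: Setting. $X$ is a continuous-time Markov chain on $S=\{0,1,2,\dots\}$ with Q-matrix $Q(i,i-1)=\mu_i$ ($i\ge1$), $Q(i,i+1)=\lambda_i$, $Q(i,i)=-(\lambda_i+\mu_i)$ ($i\ge0$), all other entries $0$, where $\lambda_i,\mu_i>0$ for $i\ge1$ and $\lambda_0=\mu_0=0$ (so $0$ is a trap). Its transition probability $P_t(i,j)=\mathbb{P}_i[X_t=j]$ satisfies the forward and backward equations $\partial_tP_t=P_tQ=QP_t$, i.e. for all $i,j\ge0$, $\partial_tP_t(i,j)=\lambda_{j-1}P_t(i,j-1)-(\lambda_j+\mu_j)P_t(i,j)+\mu_{j+1}P_t(i,j+1)$ (with $\lambda_{-1}P_t(i,-1)$ read as $0$) and $\partial_tP_t(i,j)=\mu_iP_t(i-1,j)-(\lambda_i+\mu_i)P_t(i,j)+\lambda_iP_t(i+1,j)$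 (with $\mu_0P_t(-1,j)$ read as $0$). $T_0$ is the first hitting time of $0$; since $0$ is a trap, $\mathbb{P}_i[T_0\le t]=\mathbb{P}_i[X_t=0]$. For $i\ge 1$, $t>0$, $f_i(t):=\partial_t\mathbb{P}_i[T_0\le t]$ is the density of $T_0$ under $\mathbb{P}_i$. Speed measure: $\pi_1=1$, $\pi_i=\dfrac{\lambda_1\cdots\lambda_{i-1}}{\mu_2\cdots\mu_i}$ ($i\ge2$). Scale function: $s(0)=0$, $s(i)=\frac1{\mu_1}+\sum_{j=1}^{i-1}\frac1{\pi_j\lambda_j}$ ($i\ge1$). For $f:S\to\mathbb{R}$, $Qf(i)=\mu_if(i-1)-(\lambda_i+\mu_i)f(i)+\lambda_if(i+1)$ ($i\ge0$, with $\mu_0f(-1)$ read as $0$). Matrix $C$: $C=(C(i,j))_{i,j\ge0}$, with columns $C_j=(C(i,j))_{i\ge0}$, is the unique matrix with $QC_j=C_{j-1}$ for $j\ge1$, $C_0=0$, $C(i,1)=s(i)$ for $i\ge1$, and $C(i,j)=0$ for $i<j$. Here $\partial_t=\frac{d}{dt}$.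
   Formalization: The displayed limit is false as printed (λ_i=1, μ_i=2, ν=δ_2, j=2 gives 2, not 1); the formal statement inserts the speed-measure factor: ν{j} = lim π_j ψ_{∂_t}(j) f_ν(t). *)

theory Defs
  imports "HOL-Probability.Probability"
begin

definition bd_Q :: "(nat \<Rightarrow> real) \<Rightarrow> (nat \<Rightarrow> real) \<Rightarrow> nat \<Rightarrow> nat \<Rightarrow> real" where
  "bd_Q lam mu i j =
     (if i = j + 1 then mu i
      else if j = i + 1 then lam i
      else if j = i then - (lam i + mu i)
      else 0)"

(* Row i of bd_Q vanishes beyond column i + 1, so this finite sum is (Q f)(i). *)
definition bd_gen :: "(nat \<Rightarrow> real) \<Rightarrow> (nat \<Rightarrow> real) \<Rightarrow> (nat \<Rightarrow> real) \<Rightarrow> nat \<Rightarrow> real" where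
  "bd_gen lam mu f i = (\<Sum>k\<le>i + 1. bd_Q lam mu i k * f k)"

definition trans_prob :: "(nat \<Rightarrow> 'a measure) \<Rightarrow> (real \<Rightarrow> 'a \<Rightarrow> enat) \<Rightarrow> real \<Rightarrow> nat \<Rightarrow> nat \<Rightarrow> real" where
  "trans_prob M X t i j = measure (M i) {\<omega> \<in> space (M i). X t \<omega> = enat j}"

(* M i is the law of the process started at i. The state space is the set of
   naturals; the extra value infinity is where a path may sit after (or at) an
   explosion, so that no growth condition on the rates is implied by path
   regularity. Non-explosive chains are the case in which infinity is never taken.
   The Markov property is the elementary one, multiplied out to avoid conditioning
   on null events. Derivatives at t = 0 are one-sided, and since P_0 is the identity,
   either Kolmogorov equation at t = 0 says that bd_Q is the Q-matrix of the chain. In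
   the forward equation, column j of bd_Q vanishes below row j + 1. *)
locale birth_death_process =
  fixes lam mu :: "nat \<Rightarrow> real"
    and M :: "nat \<Rightarrow> 'a measure"
    and X :: "real \<Rightarrow> 'a \<Rightarrow> enat"
  assumes rates_pos: "i \<ge> 1 \<Longrightarrow> lam i > 0" "i \<ge> 1 \<Longrightarrow> mu i > 0"
    and rates_0: "lam 0 = 0" "mu 0 = 0"
    and prob: "prob_space (M i)"
    and X_measurable: "t \<ge> 0 \<Longrightarrow> X t \<in> measurable (M i) (count_space UNIV)"
    and right_cont:
      "\<omega> \<in> space (M i) \<Longrightarrow> t \<ge> 0 \<Longrightarrow> ((\<lambda>s. X s \<omega>) \<longlongrightarrow> X t \<omega>) (at_right t)"
    and start: "AE \<omega> in M i. X 0 \<omega> = enat i"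
    and markov:
      "finite F \<Longrightarrow> F \<subseteq> {0..s} \<Longrightarrow> s \<ge> 0 \<Longrightarrow> t \<ge> 0 \<Longrightarrow>
       measure (M i) {\<omega> \<in> space (M i).
         (\<forall>u\<in>F. X u \<omega> = x u) \<and> X s \<omega> = enat k \<and> X (s + t) \<omega> = enat l}
       = measure (M i) {\<omega> \<in> space (M i). (\<forall>u\<in>F. X u \<omega> = x u) \<and> X s \<omega> = enat k}
         * trans_prob M X t k l"
    and forward:
      "t \<ge> 0 \<Longrightarrow> ((\<lambda>u. trans_prob M X u i j) has_real_derivative
         (\<Sum>k\<le>j + 1. trans_prob M X t i k * bd_Q lam mu k j)) (at t within {0..})"
    and backward:
      "t \<ge> 0 \<Longrightarrow> ((\<lambda>u. trans_prob M X u i j) has_real_derivative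
         bd_gen lam mu (\<lambda>k. trans_prob M X t k j) i) (at t within {0..})"

(* Infinite if 0 is never hit: the infimum of the empty set in ereal. *)
definition hit0 :: "(real \<Rightarrow> 'a \<Rightarrow> enat) \<Rightarrow> 'a \<Rightarrow> ereal" where
  "hit0 X \<omega> = (INF t \<in> {t. t \<ge> 0 \<and> X t \<omega> = 0}. ereal t)"

definition hit_density :: "(nat \<Rightarrow> 'a measure) \<Rightarrow> (real \<Rightarrow> 'a \<Rightarrow> enat) \<Rightarrow> nat \<Rightarrow> real \<Rightarrow> real" where
  "hit_density M X i =
     deriv (\<lambda>t. measure (M i) {\<omega> \<in> space (M i). hit0 X \<omega> \<le> ereal t})"

definition hit_density_init ::
    "(nat \<Rightarrow> 'a measure) \<Rightarrow> (real \<Rightarrow> 'a \<Rightarrow> enat) \<Rightarrow> nat pmf \<Rightarrow> real \<Rightarrow> real" where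
  "hit_density_init M X \<nu> t = (\<Sum>\<^sub>\<infinity>i\<in>{1..}. pmf \<nu> i * hit_density M X i t)"

(* Only used for i \<ge> 1; the products are empty for i = 1. *)
definition speed_measure :: "(nat \<Rightarrow> real) \<Rightarrow> (nat \<Rightarrow> real) \<Rightarrow> nat \<Rightarrow> real" where
  "speed_measure lam mu i = (\<Prod>k=1..<i. lam k) / (\<Prod>k=2..i. mu k)"

definition scale_fun :: "(nat \<Rightarrow> real) \<Rightarrow> (nat \<Rightarrow> real) \<Rightarrow> nat \<Rightarrow> real" where
  "scale_fun lam mu i =
     (if i = 0 then 0
      else 1 / mu 1 + (\<Sum>j=1..<i. 1 / (speed_measure lam mu j * lam j)))"

definition is_bd_C :: "(nat \<Rightarrow> real) \<Rightarrow> (nat \<Rightarrow> real) \<Rightarrow> (nat \<Rightarrow> nat \<Rightarrow> real) \<Rightarrow> bool" where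
  "is_bd_C lam mu C \<longleftrightarrow>
     (\<forall>j\<ge>1. \<forall>i. bd_gen lam mu (\<lambda>k. C k j) i = C i (j - 1)) \<and>
     (\<forall>i. C i 0 = 0) \<and>
     (\<forall>i\<ge>1. C i 1 = scale_fun lam mu i) \<and>
     (\<forall>i j. i < j \<longrightarrow> C i j = 0)"

definition bd_C :: "(nat \<Rightarrow> real) \<Rightarrow> (nat \<Rightarrow> real) \<Rightarrow> nat \<Rightarrow> nat \<Rightarrow> real" where
  "bd_C lam mu = (THE C. is_bd_C lam mu C)"

(* Since Q C_j = C_(j-1) is the backward recursion, while j \<mapsto> P_t(i,j) obeys the
   forward one, bd_psi j applied to the hitting density gives the transition density
   with respect to the speed measure: P_t(i,j) = speed_measure j * bd_psi j f_i (t). *)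
definition bd_psi ::
    "(nat \<Rightarrow> real) \<Rightarrow> (nat \<Rightarrow> real) \<Rightarrow> nat \<Rightarrow> (real \<Rightarrow> real) \<Rightarrow> real \<Rightarrow> real" where
  "bd_psi lam mu j g t = (\<Sum>k=1..j. bd_C lam mu j k * (deriv ^^ (k - 1)) g t)"

end

theory Submission
  imports Defs
begin

text \<open>
  Since 0 is a trap, the law of the hitting time of 0 is \<open>t \<mapsto> P\<^sub>t(\<nu>, 0)\<close>, and the forward
  equation in column 0 turns its density into \<open>\<mu>\<^sub>1 P\<^sub>t(\<nu>, 1)\<close>. The forward equation in column
  \<open>j\<close> expresses \<open>P\<^sub>t(\<nu>, j + 1)\<close> through \<open>P\<^sub>t(\<nu>, j)\<close>, its time derivative and \<open>P\<^sub>t(\<nu>, j - 1)\<close>;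
  after division by the speed measure this is the backward recursion satisfied by the rows of
  the matrix \<open>C\<close>. Hence, by induction on \<open>j\<close>, the differential polynomial reproduces
  \<open>P\<^sub>t(\<nu>, j)\<close> for \<open>t > 0\<close>, and the latter is continuous at \<open>t = 0\<close>.
\<close>

section \<open>The matrix \<open>C\<close>\<close>

lemma bd_gen_0: "bd_gen lam mu f 0 = lam 0 * f 1 - (lam 0 + mu 0) * f 0"
  by (simp add: bd_gen_def bd_Q_def algebra_simps)

lemma bd_gen_Suc:
  "bd_gen lam mu f (Suc i) =
     mu (Suc i) * f i - (lam (Suc i) + mu (Suc i)) * f (Suc i) + lam (Suc i) * f (Suc (Suc i))"
proof -
  have "bd_gen lam mu f (Suc i) = (\<Sum>k\<in>{i, Suc i, Suc (Suc i)}. bd_Q lam mu (Suc i) k * f k)"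
    unfolding bd_gen_def by (rule sum.mono_neutral_right) (auto simp: bd_Q_def)
  then show ?thesis
    by (simp add: bd_Q_def algebra_simps)
qed

lemma sum_bd_Q_column_0: "(\<Sum>k\<le>0 + 1. p k * bd_Q lam mu k 0) = mu 1 * p 1 - (lam 0 + mu 0) * p 0"
  by (simp add: bd_Q_def algebra_simps)

lemma sum_bd_Q_column_Suc:
  "(\<Sum>k\<le>Suc j + 1. p k * bd_Q lam mu k (Suc j)) =
     lam j * p j - (lam (Suc j) + mu (Suc j)) * p (Suc j) + mu (Suc (Suc j)) * p (Suc (Suc j))"
proof -
  have "(\<Sum>k\<le>Suc j + 1. p k * bd_Q lam mu k (Suc j)) =
        (\<Sum>k\<in>{j, Suc j, Suc (Suc j)}. p k * bd_Q lam mu k (Suc j))"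
    by (rule sum.mono_neutral_right) (auto simp: bd_Q_def)
  then show ?thesis
    by (simp add: bd_Q_def algebra_simps)
qed

lemma speed_measure_1: "speed_measure lam mu 1 = 1"
  by (simp add: speed_measure_def)

lemma speed_measure_Suc:
  assumes "i \<ge> 1"
  shows "speed_measure lam mu (Suc i) = speed_measure lam mu i * lam i / mu (Suc i)"
proof -
  have "{2..Suc i} = insert (Suc i) {2..i}" "{1..<Suc i} = insert i {1..<i}"
    using assms by auto
  then show ?thesis
    by (simp add: speed_measure_def mult_ac)
qed

lemma scale_fun_Suc:
  assumes "i \<ge> 1"
  shows "scale_fun lam mu (Suc i) = scale_fun lam mu i + 1 / (speed_measure lam mu i * lam i)"
  using assms by (simp add: scale_fun_def)

text \<open>\<open>Q C_j = C_(j-1)\<close> in row \<open>i + 1\<close>, solved for the entry in row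
  \<open>i + 2\<close>. In columns from 2 on, the zero entries of rows 0 and 1 start the recursion;
  column 1 is prescribed.\<close>

fun bd_C_rec :: "(nat \<Rightarrow> real) \<Rightarrow> (nat \<Rightarrow> real) \<Rightarrow> nat \<Rightarrow> nat \<Rightarrow> real" where
  "bd_C_rec lam mu i 0 = 0"
| "bd_C_rec lam mu i (Suc 0) = scale_fun lam mu i"
| "bd_C_rec lam mu 0 (Suc (Suc j)) = 0"
| "bd_C_rec lam mu (Suc 0) (Suc (Suc j)) = 0"
| "bd_C_rec lam mu (Suc (Suc i)) (Suc (Suc j)) =
     (bd_C_rec lam mu (Suc i) (Suc j) - mu (Suc i) * bd_C_rec lam mu i (Suc (Suc j))
      + (lam (Suc i) + mu (Suc i)) * bd_C_rec lam mu (Suc i) (Suc (Suc j))) / lam (Suc i)"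

lemma bd_C_rec_upper: "i < j \<Longrightarrow> bd_C_rec lam mu i j = 0"
  by (induction lam mu i j rule: bd_C_rec.induct) (auto simp: scale_fun_def)

locale birth_death_rates =
  fixes lam mu :: "nat \<Rightarrow> real"
  assumes rates_pos: "i \<ge> 1 \<Longrightarrow> lam i > 0" "i \<ge> 1 \<Longrightarrow> mu i > 0"
    and rates_0: "lam 0 = 0" "mu 0 = 0"
begin

lemma speed_measure_pos: "speed_measure lam mu i > 0"
  unfolding speed_measure_def using rates_pos by (intro divide_pos_pos prod_pos) auto

text \<open>Harmonicity is a balance of fluxes: \<open>lam\<close> times the increment above a state
  and \<open>mu\<close> times the increment below it both equal the reciprocal of the speed measure.
  At state 1 this relies on the initial increment \<open>1 / mu 1\<close>.\<close>

lemma bd_gen_scale_fun: "bd_gen lam mu (scale_fun lam mu) i = 0"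
proof (cases i)
  case 0
  then show ?thesis by (simp add: bd_gen_0 rates_0)
next
  case (Suc m)
  have pos: "lam (Suc m) > 0" "mu (Suc m) > 0" "speed_measure lam mu (Suc m) > 0"
    using rates_pos speed_measure_pos by auto
  have up: "lam (Suc m) * (scale_fun lam mu (Suc (Suc m)) - scale_fun lam mu (Suc m)) =
      1 / speed_measure lam mu (Suc m)"
    using pos by (simp add: scale_fun_Suc)
  have down: "mu (Suc m) * (scale_fun lam mu (Suc m) - scale_fun lam mu m) =
      1 / speed_measure lam mu (Suc m)"
  proof (cases "m = 0")
    case True
    then show ?thesis
      using pos by (simp add: scale_fun_def speed_measure_1[unfolded One_nat_def])
  next
    case False
    then show ?thesis
      using pos rates_pos[of m] by (simp add: scale_fun_Suc speed_measure_Suc)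
  qed
  show ?thesis
    unfolding Suc bd_gen_Suc using up down by (simp add: algebra_simps)
qed

lemma is_bd_C_bd_C_rec: "is_bd_C lam mu (bd_C_rec lam mu)"
  unfolding is_bd_C_def
proof (intro conjI allI impI)
  fix j i :: nat
  assume "j \<ge> 1"
  then consider "j = Suc 0" | k where "j = Suc (Suc k)"
    by (metis One_nat_def Suc_le_D not0_implies_Suc)
  then show "bd_gen lam mu (\<lambda>k. bd_C_rec lam mu k j) i = bd_C_rec lam mu i (j - 1)"
  proof cases
    case 1
    then show ?thesis by (simp add: bd_gen_scale_fun)
  next
    case 2
    show ?thesis
    proof (cases i)
      case 0
      then show ?thesis by (simp add: 2 bd_gen_0 rates_0 bd_C_rec_upper)
    next
      case (Suc m)
      have "lam (Suc m) \<noteq> 0"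
        using rates_pos(1)[of "Suc m"] by simp
      then show ?thesis by (simp add: 2 Suc bd_gen_Suc)
    qed
  qed
qed (auto simp: bd_C_rec_upper)

text \<open>Induction over columns, then over rows: row \<open>m + 1\<close> of the generator
  equation fixes the entry in row \<open>m + 2\<close>, because \<open>lam (Suc m)\<close> is
  nonzero. From column 2 on, triangularity supplies the two starting rows.\<close>

lemma is_bd_C_unique:
  assumes "is_bd_C lam mu C"
  shows "C = bd_C_rec lam mu"
proof -
  have "C i j = bd_C_rec lam mu i j" for i j
  proof (induction j arbitrary: i)
    case 0
    then show ?case using assms by (simp add: is_bd_C_def)
  next
    case (Suc j)
    have upper: "C i j = 0" if "i < j" for i j
      using assms that by (simp add: is_bd_C_def)
    have gen: "bd_gen lam mu (\<lambda>k. C k (Suc j)) i = C i j" for i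
      using assms unfolding is_bd_C_def by (metis One_nat_def Suc_le_mono diff_Suc_1 zero_le)
    show ?case
    proof (cases j)
      case 0
      show ?thesis
      proof (cases "i = 0")
        case True
        then show ?thesis using upper[of 0 "Suc 0"] by (simp add: 0 scale_fun_def)
      next
        case False
        then show ?thesis using assms by (simp add: 0 is_bd_C_def)
      qed
    next
      case j: (Suc k)
      show ?thesis
      proof (induction i rule: induct_nat_012)
        case (ge2 m)
        have "lam (Suc m) \<noteq> 0"
          using rates_pos(1)[of "Suc m"] by simp
        then show ?case
          using gen[of "Suc m"] ge2 Suc.IH[of "Suc m"] by (simp add: bd_gen_Suc j field_simps)
      qed (simp_all add: upper j)
    qed
  qed
  then show ?thesis by blast
qed

lemma is_bd_C_bd_C: "is_bd_C lam mu (bd_C lam mu)"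
  unfolding bd_C_def using is_bd_C_bd_C_rec is_bd_C_unique by (rule theI)

lemma bd_C_gen: "bd_gen lam mu (\<lambda>k. bd_C lam mu k (Suc j)) i = bd_C lam mu i j"
  using is_bd_C_bd_C unfolding is_bd_C_def by (metis One_nat_def Suc_le_mono diff_Suc_1 zero_le)

lemma bd_C_column_0: "bd_C lam mu i 0 = 0"
  and bd_C_1_1: "bd_C lam mu 1 1 = 1 / mu 1"
  and bd_C_upper: "i < j \<Longrightarrow> bd_C lam mu i j = 0"
  using is_bd_C_bd_C unfolding is_bd_C_def by (auto simp: scale_fun_def)

section \<open>Algebra of the differential polynomials\<close>

lemma bd_psi_conv_sum:
  assumes "j \<le> n"
  shows "bd_psi lam mu j f t = (\<Sum>k=1..n. bd_C lam mu j k * (deriv ^^ (k - 1)) f t)"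
  unfolding bd_psi_def using assms by (intro sum.mono_neutral_left) (auto simp: bd_C_upper)

lemma bd_psi_1: "bd_psi lam mu 1 f t = f t / mu 1"
  using bd_C_1_1 by (simp add: bd_psi_def)

text \<open>Acting on the row index, the generator moves column \<open>k\<close> of \<open>C\<close>
  to column \<open>k - 1\<close>, so each coefficient meets one more derivative. The right-hand side
  is thus the formal time derivative of \<open>bd_psi\<close>.\<close>

lemma bd_psi_recursion:
  "bd_gen lam mu (\<lambda>i. bd_psi lam mu i f t) j = (\<Sum>k=1..j. bd_C lam mu j k * (deriv ^^ k) f t)"
proof -
  \<comment> \<open>Zeros above the diagonal of \<open>C\<close> pad all inner sums to one common
    range, so that the sums can be exchanged.\<close>
  have "bd_gen lam mu (\<lambda>i. bd_psi lam mu i f t) j =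
      (\<Sum>i\<le>j + 1. bd_Q lam mu j i * (\<Sum>k=1..j + 1. bd_C lam mu i k * (deriv ^^ (k - 1)) f t))"
    unfolding bd_gen_def by (intro sum.cong refl) (simp add: bd_psi_conv_sum)
  also have "\<dots> = (\<Sum>k=1..j + 1. bd_gen lam mu (\<lambda>i. bd_C lam mu i k) j * (deriv ^^ (k - 1)) f t)"
    unfolding bd_gen_def sum_distrib_left sum_distrib_right mult.assoc[symmetric] by (rule sum.swap)
  also have "\<dots> = (\<Sum>k\<le>j. bd_gen lam mu (\<lambda>i. bd_C lam mu i (Suc k)) j * (deriv ^^ k) f t)"
    by (rule sum.reindex_bij_witness[of _ Suc "\<lambda>k. k - 1"]) auto
  also have "\<dots> = (\<Sum>k=1..j. bd_C lam mu j k * (deriv ^^ k) f t)"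
    unfolding bd_C_gen
    by (intro sum.mono_neutral_right) (auto simp: bd_C_column_0 Suc_le_eq intro: gr0I)
  finally show ?thesis .
qed

end

section \<open>Solutions of the forward equation\<close>

locale forward_solution = birth_death_rates +
  fixes g :: "nat \<Rightarrow> real \<Rightarrow> real"
  assumes forward_eq:
    "t > 0 \<Longrightarrow> (g j has_real_derivative (\<Sum>k\<le>j + 1. g k t * bd_Q lam mu k j)) (at t)"
begin

text \<open>A device for smoothness: the columns of \<open>bd_Q\<close> are finite, so this class is
  closed under \<open>deriv\<close>, and the iterated derivatives in \<open>bd_psi\<close> really
  exist for \<open>t > 0\<close>.\<close>

definition in_span :: "(real \<Rightarrow> real) \<Rightarrow> bool" where
  "in_span f \<longleftrightarrow> (\<exists>a n. \<forall>t>0. f t = (\<Sum>j\<le>n. a j * g j t))"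

lemma in_span_deriv:
  assumes "in_span f"
  shows "in_span (deriv f)"
    and "t > 0 \<Longrightarrow> (f has_real_derivative deriv f t) (at t)"
proof -
  obtain a n where f: "\<And>t. t > 0 \<Longrightarrow> f t = (\<Sum>j\<le>n. a j * g j t)"
    using assms unfolding in_span_def by blast
  have deriv: "(f has_real_derivative (\<Sum>j\<le>n. a j * (\<Sum>k\<le>j + 1. g k t * bd_Q lam mu k j))) (at t)"
    if "t > 0" for t
  proof (rule has_field_derivative_transform_within_open[of _ _ _ "{0<..}"])
    show "((\<lambda>t. \<Sum>j\<le>n. a j * g j t) has_real_derivative
        (\<Sum>j\<le>n. a j * (\<Sum>k\<le>j + 1. g k t * bd_Q lam mu k j))) (at t)"
      using that by (intro DERIV_sum DERIV_cmult forward_eq)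
  qed (use that f in auto)
  then show "(f has_real_derivative deriv f t) (at t)" if "t > 0"
    using that DERIV_deriv_iff_has_field_derivative by blast
  have "deriv f t = (\<Sum>k\<le>n + 1. (\<Sum>j\<le>n. a j * bd_Q lam mu k j) * g k t)" if "t > 0" for t
  proof -
    have "deriv f t = (\<Sum>j\<le>n. a j * (\<Sum>k\<le>j + 1. g k t * bd_Q lam mu k j))"
      using deriv[OF that] by (rule DERIV_imp_deriv)
    also have "\<dots> = (\<Sum>j\<le>n. a j * (\<Sum>k\<le>n + 1. g k t * bd_Q lam mu k j))"
      by (intro sum.cong refl arg_cong2[of _ _ _ _ "(*)"] sum.mono_neutral_left) (auto simp: bd_Q_def)
    also have "\<dots> = (\<Sum>k\<le>n + 1. \<Sum>j\<le>n. a j * (g k t * bd_Q lam mu k j))"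
      unfolding sum_distrib_left by (rule sum.swap)
    finally show ?thesis
      unfolding sum_distrib_right by (simp only: mult_ac)
  qed
  then show "in_span (deriv f)"
    unfolding in_span_def
    by (intro exI[of _ "\<lambda>k. \<Sum>j\<le>n. a j * bd_Q lam mu k j"] exI[of _ "n + 1"]) blast
qed

lemma in_span_deriv_iter: "in_span f \<Longrightarrow> in_span ((deriv ^^ k) f)"
  by (induction k) (auto intro: in_span_deriv)

lemma eq_speed_measure_bd_psi:
  assumes f: "\<And>t. t > 0 \<Longrightarrow> f t = mu 1 * g 1 t"
    and "j \<ge> 1" "t > 0"
  shows "g j t = speed_measure lam mu j * bd_psi lam mu j f t"
proof -
  have "in_span f"
    unfolding in_span_def
    by (intro exI[of _ "\<lambda>j. if j = 1 then mu 1 else 0"] exI[of _ 1]) (simp add: f)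
  then have deriv_iter:
    "((deriv ^^ k) f has_real_derivative (deriv ^^ Suc k) f t) (at t)" if "t > 0" for k t
    using in_span_deriv(2)[OF in_span_deriv_iter that] by simp
  have deriv_psi: "((\<lambda>t. bd_psi lam mu j f t) has_real_derivative
      bd_gen lam mu (\<lambda>i. bd_psi lam mu i f t) j) (at t)" if "t > 0" for j t
  proof -
    have "((\<lambda>t. bd_psi lam mu j f t) has_real_derivative
        (\<Sum>k=1..j. bd_C lam mu j k * (deriv ^^ Suc (k - 1)) f t)) (at t)"
      unfolding bd_psi_def using that by (intro DERIV_sum DERIV_cmult deriv_iter)
    also have "(\<Sum>k=1..j. bd_C lam mu j k * (deriv ^^ Suc (k - 1)) f t) =
        bd_gen lam mu (\<lambda>i. bd_psi lam mu i f t) j"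
      unfolding bd_psi_recursion
      by (intro sum.cong refl)
        (metis Suc_diff_1 Suc_le_eq One_nat_def atLeastAtMost_iff)
    finally show ?thesis .
  qed
  \<comment> \<open>The guard \<open>j \<ge> 1\<close> makes case 0 trivial, so two-step induction
    applies although \<open>g 0\<close> has no such formula.\<close>
  have "\<forall>t>0. j \<ge> 1 \<longrightarrow> g j t = speed_measure lam mu j * bd_psi lam mu j f t"
  proof (induction j rule: induct_nat_012)
    case 1
    then show ?case
      using rates_pos(2)[of 1] by (simp add: f bd_psi_1[simplified] speed_measure_1[simplified])
  next
    case (ge2 m)
    let ?\<pi> = "speed_measure lam mu" and ?\<psi> = "\<lambda>i t. bd_psi lam mu i f t"
    have pos: "mu (Suc m) > 0" "mu (Suc (Suc m)) > 0"
      using rates_pos(2) by auto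
    have "g (Suc (Suc m)) t = ?\<pi> (Suc (Suc m)) * ?\<psi> (Suc (Suc m)) t" if "t > 0" for t
    proof -
      \<comment> \<open>The induction hypothesis gives a second expression for the derivative of
        \<open>g (Suc m)\<close>; comparing it with the forward equation isolates
        \<open>g (Suc (Suc m))\<close>.\<close>
      have "((\<lambda>t. ?\<pi> (Suc m) * ?\<psi> (Suc m) t) has_real_derivative
          ?\<pi> (Suc m) * bd_gen lam mu (\<lambda>i. ?\<psi> i t) (Suc m)) (at t)"
        using that by (intro DERIV_cmult deriv_psi)
      then have "(g (Suc m) has_real_derivative
          ?\<pi> (Suc m) * bd_gen lam mu (\<lambda>i. ?\<psi> i t) (Suc m)) (at t)"
        by (rule has_field_derivative_transform_within_open[of _ _ _ "{0<..}"]) (use that ge2 in auto)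
      from DERIV_unique[OF this forward_eq[OF that]]
      have "?\<pi> (Suc m) * bd_gen lam mu (\<lambda>i. ?\<psi> i t) (Suc m) =
          lam m * g m t - (lam (Suc m) + mu (Suc m)) * g (Suc m) t
            + mu (Suc (Suc m)) * g (Suc (Suc m)) t"
        unfolding sum_bd_Q_column_Suc .
      \<comment> \<open>Detailed balance
        \<open>?\<pi> (Suc m) * mu (Suc m) = ?\<pi> m * lam m\<close> for \<open>m \<ge> 1\<close>.
        For \<open>m = 0\<close> both sides vanish: \<open>lam 0 = 0\<close>, and
        \<open>bd_psi\<close> at 0 is an empty sum.\<close>
      moreover have "lam m * g m t = ?\<pi> (Suc m) * mu (Suc m) * ?\<psi> m t"
      proof (cases "m = 0")
        case True
        then show ?thesis by (simp add: rates_0 bd_psi_def)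
      next
        case False
        then show ?thesis using ge2 that pos by (simp add: speed_measure_Suc)
      qed
      moreover have "g (Suc m) t = ?\<pi> (Suc m) * ?\<psi> (Suc m) t"
        using ge2 that by simp
      ultimately have "mu (Suc (Suc m)) * g (Suc (Suc m)) t =
          ?\<pi> (Suc m) * lam (Suc m) * ?\<psi> (Suc (Suc m)) t"
        unfolding bd_gen_Suc by (simp add: algebra_simps)
      then show ?thesis
        using pos by (simp add: speed_measure_Suc[of "Suc m"] field_simps)
    qed
    then show ?case by simp
  qed simp
  then show ?thesis
    using assms by blast
qed

end

section \<open>The hitting time of 0\<close>

text \<open>0 is isolated in \<open>enat\<close>, being the only value below 1.\<close>

lemma eventually_at_right_eq_0:
  fixes f :: "real \<Rightarrow> enat"
  assumes "(f \<longlongrightarrow> 0) (at_right t)"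
  shows "eventually (\<lambda>s. f s = 0) (at_right t)"
  using order_tendstoD(2)[OF assms, of 1] by (simp add: ileI1 one_eSuc iless_eSuc0)

lemma pmf_nat_sums: "(\<lambda>i. pmf p i) sums 1" for p :: "nat pmf"
proof -
  have "(\<lambda>i. measure p {i}) sums measure p (\<Union>i. {i})"
    by (rule measure_pmf.finite_measure_UNION) (auto simp: disjoint_family_on_def)
  then show ?thesis
    by (simp add: measure_pmf_single flip: pmf.rep_eq)
qed

sublocale birth_death_process \<subseteq> rates: birth_death_rates lam mu
  by unfold_locales (use rates_pos rates_0 in auto)

context birth_death_process
begin

section \<open>Transition probabilities and absorption at 0\<close>

abbreviation P :: "real \<Rightarrow> nat \<Rightarrow> nat \<Rightarrow> real" where
  "P \<equiv> trans_prob M X"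

lemma sets_X_eq: "t \<ge> 0 \<Longrightarrow> {\<omega> \<in> space (M i). X t \<omega> = x} \<in> sets (M i)"
  using measurable_sets[OF X_measurable, of t "{x}" i] by (simp add: vimage_def Int_def conj_commute)

lemma P_nonneg: "0 \<le> P t i j"
  by (simp add: trans_prob_def)

lemma P_le_1: "P t i j \<le> 1"
  unfolding trans_prob_def using prob_space.prob_le_1[OF prob] .

lemma P_at_0: "P 0 i j = (if j = i then 1 else 0)"
proof -
  interpret prob_space "M i" by (rule prob)
  have "P 0 i j = prob {\<omega> \<in> space (M i). i = j}"
    unfolding trans_prob_def
    by (rule measure_eq_AE) (use start[of i] in \<open>auto intro: sets_X_eq elim!: eventually_mono\<close>)
  then show ?thesis
    by (auto simp: prob_space)
qed

text \<open>Row 0 of \<open>bd_Q\<close> is zero, so the backward equation keeps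
  \<open>P u 0 0\<close> at its initial value.\<close>

lemma P_trap:
  assumes "t \<ge> 0"
  shows "P t 0 0 = 1"
proof -
  have "\<exists>c. \<forall>u\<in>{0..}. P u 0 0 = c"
  proof (rule has_field_derivative_zero_constant)
    show "((\<lambda>u. P u 0 0) has_real_derivative 0) (at u within {0..})" if "u \<in> {0..}" for u
      using backward[of u 0 0] that by (simp add: bd_gen_0 rates_0)
  qed simp
  then show ?thesis
    using assms P_at_0[of 0 0] by force
qed

text \<open>By the Markov property with \<open>F = {}\<close> and \<open>P_trap\<close>, requiring a
  zero at \<open>t\<close> in addition to one at \<open>q\<close> does not lower the
  probability.\<close>

lemma AE_X_stays_0:
  assumes "0 \<le> q" "q \<le> t"
  shows "AE \<omega> in M i. X q \<omega> = 0 \<longrightarrow> X t \<omega> = 0"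
proof -
  interpret prob_space "M i" by (rule prob)
  let ?A = "\<lambda>s. {\<omega> \<in> space (M i). X s \<omega> = 0}"
  have sets: "?A q \<in> sets (M i)" "?A t \<in> sets (M i)"
    using assms by (auto intro: sets_X_eq)
  have "prob (?A q \<inter> ?A t) = prob (?A q)"
    using markov[of "{}" q "t - q" i "\<lambda>_. 0" 0 0] P_trap[of "t - q"] assms
    by (simp add: Int_def enat_0 conj_ac cong: conj_cong)
  then have "prob (?A q - ?A t) = 0"
    using finite_measure_Diff'[of "?A q" "?A t"] sets by simp
  then have "prob {\<omega> \<in> space (M i). X q \<omega> = 0 \<and> X t \<omega> \<noteq> 0} = 0"
    by (simp add: set_diff_eq conj_ac cong: conj_cong)
  moreover have "{\<omega> \<in> space (M i). X q \<omega> = 0 \<and> X t \<omega> \<noteq> 0} \<in> sets (M i)"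
    using sets by measurable
  ultimately show ?thesis
    by (simp add: prob_Collect_eq_0)
qed

text \<open>Without a zero in \<open>{0..t}\<close>, the infimum could be at most \<open>t\<close>
  only through zeros accumulating at \<open>t\<close> from the right. Right-continuity excludes
  this, since a path nonzero at \<open>t\<close> stays nonzero just afterwards.\<close>

lemma hit0_le_iff:
  assumes "\<omega> \<in> space (M i)" "t \<ge> 0"
  shows "hit0 X \<omega> \<le> ereal t \<longleftrightarrow> (\<exists>s\<in>{0..t}. X s \<omega> = 0)"
proof
  assume le: "hit0 X \<omega> \<le> ereal t"
  show "\<exists>s\<in>{0..t}. X s \<omega> = 0"
  proof (rule ccontr)
    assume not_hit: "\<not> (\<exists>s\<in>{0..t}. X s \<omega> = 0)"
    then have "X t \<omega> \<noteq> 0"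
      using assms by auto
    then have "eventually (\<lambda>s. X s \<omega> \<noteq> 0) (at_right t)"
      using right_cont[OF assms] by (rule tendsto_imp_eventually_ne[rotated])
    then obtain b where b: "b > t" "\<And>s. t < s \<Longrightarrow> s < b \<Longrightarrow> X s \<omega> \<noteq> 0"
      unfolding eventually_at_right_field by blast
    have "hit0 X \<omega> < ereal b"
      using le by (rule le_less_trans) (simp add: b(1))
    then obtain s where "s \<ge> 0" "X s \<omega> = 0" "s < b"
      unfolding hit0_def INF_less_iff by auto
    then show False
      using b(2)[of s] not_hit by force
  qed
next
  assume "\<exists>s\<in>{0..t}. X s \<omega> = 0"
  then obtain s where "0 \<le> s" "s \<le> t" "X s \<omega> = 0"
    by auto
  then show "hit0 X \<omega> \<le> ereal t"
    unfolding hit0_def by (intro INF_lower2[of s]) auto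
qed

text \<open>Right-continuity reduces the uncountably many times in \<open>{0..t}\<close> to rational ones.\<close>

lemma hit0_le_iff_rational:
  assumes "\<omega> \<in> space (M i)" "t \<ge> 0"
  shows "hit0 X \<omega> \<le> ereal t \<longleftrightarrow> (\<exists>q\<in>insert t (\<rat> \<inter> {0..t}). X q \<omega> = 0)"
  unfolding hit0_le_iff[OF assms]
proof
  assume "\<exists>s\<in>{0..t}. X s \<omega> = 0"
  then obtain s where s: "0 \<le> s" "s \<le> t" "X s \<omega> = 0"
    by auto
  show "\<exists>q\<in>insert t (\<rat> \<inter> {0..t}). X q \<omega> = 0"
  \<comment> \<open>A zero before \<open>t\<close> leaves room for a rational time; a zero at
    \<open>t\<close> itself need not, which is why \<open>t\<close> is added to the
    rationals.\<close>
  proof (cases "s = t")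
    case False
    have "eventually (\<lambda>u. X u \<omega> = 0) (at_right s)"
      using right_cont[OF assms(1) s(1)] s(3) by (intro eventually_at_right_eq_0) simp
    then obtain b where b: "b > s" "\<And>u. s < u \<Longrightarrow> u < b \<Longrightarrow> X u \<omega> = 0"
      unfolding eventually_at_right_field by blast
    obtain q where "q \<in> \<rat>" "s < q" "q < min b t"
      using Rats_dense_in_real[of s "min b t"] b(1) s False by auto
    then show ?thesis
      using b(2)[of q] s by (intro bexI[of _ q]) auto
  qed (use s in auto)
qed (use assms in auto)

text \<open>Outside a countable union of null sets, a zero at any time in \<open>?T\<close> persists
  until \<open>t\<close>. The same countable set yields measurability of the hitting event.\<close>

lemma measure_hit0_le:
  assumes "t \<ge> 0"
  shows "measure (M i) {\<omega> \<in> space (M i). hit0 X \<omega> \<le> ereal t} = P t i 0"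
  unfolding trans_prob_def
proof (rule measure_eq_AE)
  let ?T = "insert t (\<rat> \<inter> {0..t})"
  have countable: "countable ?T"
    using countable_rat by blast
  have "AE \<omega> in M i. \<forall>q\<in>?T. X q \<omega> = 0 \<longrightarrow> X t \<omega> = 0"
    using assms countable by (intro AE_ball_countable' AE_X_stays_0) auto
  then show "AE \<omega> in M i. \<omega> \<in> {\<omega> \<in> space (M i). hit0 X \<omega> \<le> ereal t} \<longleftrightarrow>
      \<omega> \<in> {\<omega> \<in> space (M i). X t \<omega> = enat 0}"
    using AE_space by eventually_elim (use assms in \<open>auto simp: hit0_le_iff_rational enat_0\<close>)
  have "{\<omega> \<in> space (M i). hit0 X \<omega> \<le> ereal t} = (\<Union>q\<in>?T. {\<omega> \<in> space (M i). X q \<omega> = 0})"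
    using assms by (auto simp: hit0_le_iff_rational)
  also have "\<dots> \<in> sets (M i)"
    by (rule sets.countable_UN'[OF countable]) (use assms in \<open>auto intro: sets_X_eq\<close>)
  finally show "{\<omega> \<in> space (M i). hit0 X \<omega> \<le> ereal t} \<in> sets (M i)" .
qed (use assms in \<open>auto intro: sets_X_eq\<close>)

lemma hit_density_eq:
  assumes "t > 0"
  shows "hit_density M X i t = mu 1 * P t i 1"
proof -
  \<comment> \<open>At an interior time the derivative within \<open>{0..}\<close> is two-sided, as
    \<open>deriv\<close> requires.\<close>
  have "((\<lambda>u. P u i 0) has_real_derivative mu 1 * P t i 1) (at t)"
    using forward[of t i 0] assms unfolding sum_bd_Q_column_0
    by (simp add: rates_0 at_within_interior[of t "{0..}"])
  then have "((\<lambda>t. measure (M i) {\<omega> \<in> space (M i). hit0 X \<omega> \<le> ereal t})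
      has_real_derivative mu 1 * P t i 1) (at t)"
    by (rule has_field_derivative_transform_within_open[of _ _ _ "{0<..}"])
      (use assms in \<open>auto simp: measure_hit0_le\<close>)
  then show ?thesis
    unfolding hit_density_def by (rule DERIV_imp_deriv)
qed

section \<open>The chain with initial law \<nu>\<close>

definition init_prob :: "nat pmf \<Rightarrow> nat \<Rightarrow> real \<Rightarrow> real" where
  "init_prob \<nu> j t = (\<Sum>i. pmf \<nu> i * P t i j)"

text \<open>Absolute convergence allows the ordinary series to be identified with the
  \<open>infsum\<close> in \<open>hit_density_init\<close>.\<close>

lemma abs_summable_init_prob: "summable (\<lambda>i. norm (pmf \<nu> i * P t i j))"
  by (rule summable_comparison_test'[OF sums_summable[OF pmf_nat_sums[of \<nu>]], of 0])
    (simp add: abs_mult P_nonneg P_le_1 mult_left_le)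

lemma init_prob_sums: "(\<lambda>i. pmf \<nu> i * P t i j) sums init_prob \<nu> j t"
  unfolding init_prob_def
  by (rule summable_sums[OF summable_norm_cancel[OF abs_summable_init_prob]])

lemma init_prob_at_0: "init_prob \<nu> j 0 = pmf \<nu> j"
proof -
  have "pmf \<nu> i * P 0 i j = (if i = j then pmf \<nu> i else 0)" for i
    by (simp add: P_at_0)
  then have "(\<lambda>i. pmf \<nu> i * P 0 i j) sums pmf \<nu> j"
    using sums_single[of j "pmf \<nu>"] by simp
  with init_prob_sums show ?thesis
    by (rule sums_unique2)
qed

text \<open>
  The forward equation bounds the time derivative of \<open>P\<^sub>t(i, j)\<close> by a constant that does not
  depend on \<open>i\<close>, so the sum over \<open>i\<close> may be differentiated termwise.
\<close>

lemma init_prob_forward: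
  assumes "t \<ge> 0"
  shows "(init_prob \<nu> j has_real_derivative (\<Sum>k\<le>j + 1. init_prob \<nu> k t * bd_Q lam mu k j))
    (at t within {0..})"
proof -
  define d where "d i t = pmf \<nu> i * (\<Sum>k\<le>j + 1. P t i k * bd_Q lam mu k j)" for i t
  define K where "K = (\<Sum>k\<le>j + 1. \<bar>bd_Q lam mu k j\<bar>)"
  have "\<bar>\<Sum>k\<le>j + 1. P t i k * bd_Q lam mu k j\<bar> \<le> K" for t i
    unfolding K_def
    by (rule sum_abs[THEN order_trans], rule sum_mono)
      (simp add: abs_mult P_nonneg P_le_1 mult_left_le_one_le)
  then have "norm (d i t) \<le> pmf \<nu> i * K" for i t
    unfolding d_def by (auto simp: abs_mult intro!: mult_left_mono)
  moreover have "summable (\<lambda>i. pmf \<nu> i * K)"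
    using pmf_nat_sums[of \<nu>] by (intro summable_mult2 sums_summable)
  ultimately have "uniform_limit {0..} (\<lambda>n t. \<Sum>i<n. d i t) (\<lambda>t. \<Sum>i. d i t) sequentially"
    by (intro Weierstrass_m_test)
  then have "\<exists>h. \<forall>t\<in>{0..}. (\<lambda>i. pmf \<nu> i * P t i j) sums h t \<and>
      (h has_real_derivative (\<Sum>i. d i t)) (at t within {0..})"
  proof (rule has_field_derivative_series[rotated 2])
    show "((\<lambda>t. pmf \<nu> i * P t i j) has_real_derivative d i t) (at t within {0..})"
      if "t \<in> {0..}" for i t
      unfolding d_def using that by (intro DERIV_cmult forward) simp
    show "summable (\<lambda>i. pmf \<nu> i * P 0 i j)"
      using init_prob_sums by (rule sums_summable)
  qed auto
  then obtain h where h: "\<And>t. t \<in> {0..} \<Longrightarrow> (\<lambda>i. pmf \<nu> i * P t i j) sums h t"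
    "\<And>t. t \<in> {0..} \<Longrightarrow> (h has_real_derivative (\<Sum>i. d i t)) (at t within {0..})"
    by blast
  \<comment> \<open>The inner sum is finite, so the series of derivatives can be evaluated
    separately for each \<open>k\<close>.\<close>
  have "(\<lambda>i. d i t) sums (\<Sum>k\<le>j + 1. init_prob \<nu> k t * bd_Q lam mu k j)"
    unfolding d_def sum_distrib_left mult.assoc[symmetric]
    by (intro sums_sum sums_mult2 init_prob_sums)
  with h(2)[of t] assms
  have "(h has_real_derivative (\<Sum>k\<le>j + 1. init_prob \<nu> k t * bd_Q lam mu k j)) (at t within {0..})"
    by (simp add: sums_iff)
  then show ?thesis
  proof (rule has_field_derivative_transform_within[of _ _ _ _ 1])
    show "h t = init_prob \<nu> j t" if "t \<in> {0..}" for t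
      using h(1)[OF that] init_prob_sums by (rule sums_unique2)
  qed (use assms in auto)
qed

lemma forward_solution_init_prob: "forward_solution lam mu (init_prob \<nu>)"
proof
  show "(init_prob \<nu> j has_real_derivative (\<Sum>k\<le>j + 1. init_prob \<nu> k t * bd_Q lam mu k j)) (at t)"
    if "t > 0" for t j
    using init_prob_forward[of t \<nu> j] that by (simp add: at_within_interior[of t "{0..}"])
qed

lemma hit_density_init_eq:
  assumes "pmf \<nu> 0 = 0" "t > 0"
  shows "hit_density_init M X \<nu> t = mu 1 * init_prob \<nu> 1 t"
proof -
  have "hit_density_init M X \<nu> t = (\<Sum>\<^sub>\<infinity>i\<in>UNIV. mu 1 * (pmf \<nu> i * P t i 1))"
    unfolding hit_density_init_def
  proof (rule infsum_cong_neutral)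
    \<comment> \<open>Index 0 is missing from \<open>hit_density_init\<close>; it may be added
      because \<nu> has no mass there.\<close>
    show "mu 1 * (pmf \<nu> i * P t i 1) = 0" if "i \<in> UNIV - {1..}" for i
      using that assms(1) by (cases i) auto
  qed (use assms(2) in \<open>auto simp: hit_density_eq\<close>)
  also have "\<dots> = mu 1 * init_prob \<nu> 1 t"
    by (simp add: infsum_cmult_right'
        infsumI[OF norm_summable_imp_has_sum[OF abs_summable_init_prob init_prob_sums]])
  finally show ?thesis .
qed

end

text \<open>The normalisation of column 1 of \<open>C\<close> by the scale function makes
  \<open>bd_psi\<close> produce a density with respect to the speed measure. Without the factor in
  front, the limit would be \<open>pmf \<nu> j / speed_measure lam mu j\<close>.\<close>

theorem corollary1p2:
  fixes lam mu :: "nat \<Rightarrow> real"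
    and M :: "nat \<Rightarrow> 'a measure"
    and X :: "real \<Rightarrow> 'a \<Rightarrow> enat"
    and \<nu> :: "nat pmf"
    and j :: nat
  assumes "birth_death_process lam mu M X"
    and "pmf \<nu> 0 = 0"
    and "j \<ge> 1"
  shows "((\<lambda>t. speed_measure lam mu j * bd_psi lam mu j (hit_density_init M X \<nu>) t)
           \<longlongrightarrow> pmf \<nu> j) (at_right 0)"
proof -
  interpret birth_death_process lam mu M X by (rule assms(1))
  interpret forward_solution lam mu "init_prob \<nu>" by (rule forward_solution_init_prob)
  \<comment> \<open>The forward equation for \<open>init_prob\<close> includes the endpoint 0, which
    gives continuity there.\<close>
  have "(init_prob \<nu> j \<longlongrightarrow> init_prob \<nu> j 0) (at 0 within {0..})"
    using DERIV_continuous[OF init_prob_forward[of 0 \<nu> j]] by (simp add: continuous_within)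
  then have "(init_prob \<nu> j \<longlongrightarrow> pmf \<nu> j) (at_right 0)"
    unfolding init_prob_at_0 by (rule tendsto_within_subset) auto
  moreover have "eventually (\<lambda>t. init_prob \<nu> j t =
      speed_measure lam mu j * bd_psi lam mu j (hit_density_init M X \<nu>) t) (at_right 0)"
    using eventually_at_right_less
  proof (rule eventually_mono)
    show "init_prob \<nu> j t = speed_measure lam mu j * bd_psi lam mu j (hit_density_init M X \<nu>) t"
      if "t > 0" for t
      using hit_density_init_eq[OF assms(2)] assms(3) that by (rule eq_speed_measure_bd_psi)
  qed
  ultimately show ?thesis
    by (rule Lim_transform_eventually)
qed

end
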